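(* Let $\tau \in [0,1/4]$ be the solution to $$ \max\big\{ y(1-2y)(y-\tau)^2 : y \in [0,1/2] \big\} = \frac{\tau^2}{18}, $$ and let $c := -3/\tau$. The error of best approximation on the simplex $S \subseteq \mathbb{R}^3$ to the monomial $m_{(2,1,1)}(x_1,x_2,x_3) = x_1^2 x_2 x_3$ by trivariate polynomials of degree at most $3$ is $$ E_{\mathcal{P}_3^3}(m_{(2,1,1)}, S) = \frac{1}{2c^2}, $$ while a Chebyshev polynomial (for $m_{(2,1,1)}$ relative to $S$) is given by $$ P(x) = x_1^2 x_2 x_3 + \frac{1}{2c^2}\Big[ -16 x_1^2 (x_2+x_3) + 16 x_1 (x_2+x_3)^2 - 2(64 + 12c + c^2)\, x_1 x_2 x_3 + 8 x_2 x_3 - 2(x_2+x_3) + 1 \Big]. $$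
   Context: $S = \{ x \in \mathbb{R}^3 : x_1,x_2,x_3 \ge 0 \text{ and } x_1 + x_2 + x_3 \le 1 \}$. $\mathcal{P}_3^3$ is the space of real polynomials in three variables of total degree at most $3$. $\|g\|_S = \max_{x \in S} |g(x)|$ and $E_{\mathcal{P}_3^3}(f,S) = \min_{p \in \mathcal{P}_3^3} \|f - p\|_S$. A Chebyshev polynomial for a monomial $m_k$ of degree $n$ relative to a domain $\Omega$ is a polynomial of the form $m_k - p^*$, where $p^*$ is a best approximant to $m_k$ from the polynomials of total degree at most $n-1$, i.e., a minimizer of $\|m_k - p\|_\Omega$; here this means that $P - m_{(2,1,1)} \in \mathcal{P}_3^3$ and $\|P\|_S = E_{\mathcal{P}_3^3}(m_{(2,1,1)},S)$. Chebyshev polynomials need not be unique. *)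

theory Defs
  imports "HOL-Analysis.Analysis"
begin

text \<open>
  Real polynomials on \<open>real ^ 'n\<close> are represented by the functions they induce; a monomial
  is given by its vector of exponents.
\<close>

definition monomial_fun :: "nat ^ 'n \<Rightarrow> real ^ 'n \<Rightarrow> real" where
  "monomial_fun k x = (\<Prod>i\<in>UNIV. (x $ i) ^ (k $ i))"

definition total_degree :: "nat ^ 'n \<Rightarrow> nat" where
  "total_degree k = (\<Sum>i\<in>UNIV. k $ i)"

definition poly_space :: "nat \<Rightarrow> (real ^ 'n \<Rightarrow> real) set" where
  "poly_space n =
     {p. \<exists>a. \<forall>x. p x = (\<Sum>k | total_degree k \<le> n. a k * monomial_fun k x)}"

text \<open>The index set of the sum above is finite, so the sum is not a degenerate zero.\<close>

lemma finite_total_degree_le: "finite {k :: nat ^ 'n. total_degree k \<le> n}"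
proof (rule finite_subset)
  show "{k :: nat ^ 'n. total_degree k \<le> n}
      \<subseteq> vec_lambda ` (UNIV \<rightarrow>\<^sub>E {..n})"
  proof
    fix k :: "nat ^ 'n"
    assume "k \<in> {k. total_degree k \<le> n}"
    then have "k $ i \<le> n" for i
      using member_le_sum[of i UNIV "\<lambda>i. k $ i"] by (simp add: total_degree_def)
    then have "vec_nth k \<in> UNIV \<rightarrow>\<^sub>E {..n}"
      by auto
    then show "k \<in> vec_lambda ` (UNIV \<rightarrow>\<^sub>E {..n})"
      by (metis image_eqI vec_nth_inverse)
  qed
qed (auto intro!: finite_imageI finite_PiE)

text \<open>
  The supremum is a maximum whenever \<open>\<Omega>\<close> is compact and nonempty and \<open>g\<close> is continuous.
\<close>

definition sup_norm :: "'a set \<Rightarrow> ('a \<Rightarrow> real) \<Rightarrow> real" where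
  "sup_norm \<Omega> g = (SUP x\<in>\<Omega>. \<bar>g x\<bar>)"

text \<open>
  The error is an infimum; it is a minimum precisely when a best approximant exists.
\<close>

definition best_approx_error :: "('a \<Rightarrow> real) set \<Rightarrow> ('a \<Rightarrow> real) \<Rightarrow> 'a set \<Rightarrow> real" where
  "best_approx_error V f \<Omega> = (INF p\<in>V. sup_norm \<Omega> (\<lambda>x. f x - p x))"

definition best_approximant ::
    "('a \<Rightarrow> real) set \<Rightarrow> ('a \<Rightarrow> real) \<Rightarrow> 'a set \<Rightarrow> ('a \<Rightarrow> real) \<Rightarrow> bool" where
  "best_approximant V f \<Omega> p \<longleftrightarrow>
     p \<in> V \<and> (\<forall>q\<in>V. sup_norm \<Omega> (\<lambda>x. f x - p x) \<le> sup_norm \<Omega> (\<lambda>x. f x - q x))"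

definition chebyshev_polynomial ::
    "nat ^ 'n \<Rightarrow> (real ^ 'n) set \<Rightarrow> (real ^ 'n \<Rightarrow> real) \<Rightarrow> bool" where
  "chebyshev_polynomial k \<Omega> P \<longleftrightarrow>
     total_degree k > 0 \<and>
     (\<exists>p. best_approximant (poly_space (total_degree k - 1)) (monomial_fun k) \<Omega> p \<and>
          P = (\<lambda>x. monomial_fun k x - p x))"

definition std_simplex3 :: "(real ^ 3) set" where
  "std_simplex3 = {x. 0 \<le> x $ 1 \<and> 0 \<le> x $ 2 \<and> 0 \<le> x $ 3 \<and> x $ 1 + x $ 2 + x $ 3 \<le> 1}"

definition tau_solution :: "real \<Rightarrow> bool" where
  "tau_solution \<tau> \<longleftrightarrow>
     \<tau> \<in> {0..1/4} \<and> (SUP y\<in>{0..1/2}. y * (1 - 2 * y) * (y - \<tau>)\<^sup>2) = \<tau>\<^sup>2 / 18"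

end

theory Submission
  imports Defs
begin

text \<open>
  Let \<open>Q = 2 c\<^sup>2 P\<close> (\<open>scaled_chebyshev\<close>). The theorem says that \<open>Q\<close> is bounded by \<open>1\<close> on the
  simplex and that no other choice of the terms of degree at most \<open>3\<close> gives a smaller maximum
  of the absolute value.

  The upper bound rests on the fact that \<open>Q\<close> depends only on \<open>x = x\<^sub>1\<close>, \<open>s = x\<^sub>2 + x\<^sub>3\<close> and
  \<open>p = x\<^sub>2 x\<^sub>3\<close>, and is affine in \<open>p\<close>, where \<open>p\<close> ranges over \<open>[0, s\<^sup>2/4]\<close>. So only the two extreme
  values of \<open>p\<close> matter. For \<open>p = 0\<close>, \<open>Q\<close> is a bivariate cubic that on the edge \<open>x + s = 1\<close> is a
  Chebyshev polynomial \<open>- T\<^sub>3 (2 s - 1)\<close> (\<open>cubic_edge_bound\<close>). For \<open>p = s\<^sup>2/4\<close>, that is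
  \<open>x\<^sub>2 = x\<^sub>3 = y\<close>, it equals \<open>1 - 4 y (1 - 2 y) (3 + c y)\<^sup>2\<close> on the edge \<open>x + 2 y = 1\<close>. The equation
  for \<open>\<tau>\<close> says exactly that this function oscillates between \<open>1\<close> and \<open>- 1\<close>; it equals \<open>1\<close> at
  \<open>y = \<tau>\<close>, because \<open>3 + c \<tau> = 0\<close>, and \<open>- 1\<close> at a point \<open>y\<^sub>0\<close> with \<open>\<tau> < y\<^sub>0 < 1/2\<close>. Away from that edge
  the function is quadratic in \<open>x\<close>, and its lower bound only needs \<open>c\<close> to two decimals
  (\<open>quartic_symmetric_bound\<close>).

  The lower bound is by duality. Ten points of the face \<open>x\<^sub>1 + x\<^sub>2 + x\<^sub>3 = 1\<close> at which \<open>Q\<close> is \<open>1\<close> or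
  \<open>- 1\<close> carry weights, with the sign of \<open>Q\<close>, such that the weighted sum of values vanishes on
  all cubics (\<open>simplex_signature\<close>). Applied to \<open>f - q\<close>, for \<open>q\<close> cubic, the functional gives the
  same value as on \<open>P\<close>, which is the sum of the absolute weights times \<open>1 / (2 c\<^sup>2)\<close>; hence
  \<open>f - q\<close> cannot be uniformly smaller than that (\<open>best_approximant_of_signature\<close>).

  Existence and uniqueness of \<open>\<tau>\<close> come from solving the inequality
  \<open>y (1 - 2 y) (y - \<tau>)\<^sup>2 \<le> \<tau>\<^sup>2 / 18\<close> for \<open>\<tau>\<close>: it is strict for \<open>0 \<le> y \<le> \<tau>\<close> with \<open>\<tau>\<close> positive,
  and for \<open>y > \<tau>\<close> it reads \<open>h y \<le> \<tau>\<close> for an explicit continuous function \<open>h\<close>, so \<open>\<tau>\<close> is the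
  maximum of \<open>h\<close>.
\<close>

section \<open>Certifying a best approximation by an annihilating signature\<close>

lemma abs_le_sup_norm:
  assumes "bdd_above ((\<lambda>x. \<bar>g x\<bar>) ` \<Omega>)" "x \<in> \<Omega>"
  shows "\<bar>g x\<bar> \<le> sup_norm \<Omega> g"
  unfolding sup_norm_def by (rule cSUP_upper[OF assms(2,1)])

text \<open>
  The functional \<open>p \<mapsto> \<Sum> w * p x\<close> takes the same value at \<open>P\<close>, \<open>f - q\<close> and \<open>f\<close>, since \<open>f - P\<close> and \<open>q\<close>
  lie in \<open>V\<close>. Its value at \<open>P\<close> is as large as the bound \<open>E\<close> permits, because every weight has the
  sign of \<open>P\<close> at its point.
\<close>

lemma error_ge_of_signature:
  fixes L :: "(real \<times> 'a) list"
  assumes mem: "(\<lambda>x. f x - P x) \<in> V" and q: "q \<in> V"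
    and bdd: "bdd_above ((\<lambda>x. \<bar>f x - q x\<bar>) ` \<Omega>)"
    and ann: "\<And>p. p \<in> V \<Longrightarrow> (\<Sum>(w, x)\<leftarrow>L. w * p x) = 0"
    and sig: "\<And>w x. (w, x) \<in> set L \<Longrightarrow> x \<in> \<Omega> \<and> w * P x = \<bar>w\<bar> * E"
    and pos: "(\<Sum>(w, x)\<leftarrow>L. \<bar>w\<bar>) > 0"
  shows "E \<le> sup_norm \<Omega> (\<lambda>x. f x - q x)"
proof -
  let ?N = "sup_norm \<Omega> (\<lambda>x. f x - q x)"
  have "(\<Sum>(w, x)\<leftarrow>L. \<bar>w\<bar>) * E = (\<Sum>(w, x)\<leftarrow>L. \<bar>w\<bar> * E)"
    by (simp add: sum_list_mult_const case_prod_unfold)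
  also have "\<dots> = (\<Sum>(w, x)\<leftarrow>L. w * P x)"
    using sig by (intro arg_cong[of _ _ sum_list] map_cong) auto
  \<comment> \<open>\<open>P = (f - q) + q - (f - P)\<close>, and the last two terms lie in \<open>V\<close>\<close>
  also have "\<dots> = (\<Sum>(w, x)\<leftarrow>L. w * (f x - q x))
      + (\<Sum>(w, x)\<leftarrow>L. w * q x) - (\<Sum>(w, x)\<leftarrow>L. w * (f x - P x))"
    by (simp add: case_prod_unfold flip: sum_list_addf sum_list_subtractf)
       (simp add: algebra_simps)
  also have "\<dots> = (\<Sum>(w, x)\<leftarrow>L. w * (f x - q x))"
    using ann[OF q] ann[OF mem] by simp
  also have "\<dots> \<le> (\<Sum>(w, x)\<leftarrow>L. \<bar>w\<bar> * ?N)"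
  proof (rule sum_list_mono, clarsimp)
    fix w x assume "(w, x) \<in> set L"
    then have "\<bar>f x - q x\<bar> \<le> ?N"
      using abs_le_sup_norm[OF bdd] sig by blast
    then have "\<bar>w * (f x - q x)\<bar> \<le> \<bar>w\<bar> * ?N"
      by (simp add: abs_mult mult_left_mono)
    then show "w * (f x - q x) \<le> \<bar>w\<bar> * ?N"
      by linarith
  qed
  also have "\<dots> = (\<Sum>(w, x)\<leftarrow>L. \<bar>w\<bar>) * ?N"
    by (simp add: sum_list_mult_const case_prod_unfold)
  finally show ?thesis
    using pos by simp
qed

lemma best_approximant_of_signature:
  fixes L :: "(real \<times> 'a) list"
  assumes mem: "(\<lambda>x. f x - P x) \<in> V"
    and bdd: "\<And>q. q \<in> V \<Longrightarrow> bdd_above ((\<lambda>x. \<bar>f x - q x\<bar>) ` \<Omega>)"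
    and ann: "\<And>p. p \<in> V \<Longrightarrow> (\<Sum>(w, x)\<leftarrow>L. w * p x) = 0"
    and sig: "\<And>w x. (w, x) \<in> set L \<Longrightarrow> x \<in> \<Omega> \<and> w * P x = \<bar>w\<bar> * E"
    and pos: "(\<Sum>(w, x)\<leftarrow>L. \<bar>w\<bar>) > 0"
    and le: "\<And>x. x \<in> \<Omega> \<Longrightarrow> \<bar>P x\<bar> \<le> E"
  shows "best_approximant V f \<Omega> (\<lambda>x. f x - P x)" and "best_approx_error V f \<Omega> = E"
proof -
  let ?N = "\<lambda>q. sup_norm \<Omega> (\<lambda>x. f x - q x)"
  have lower: "E \<le> ?N q" if "q \<in> V" for q
    by (rule error_ge_of_signature[OF mem that bdd[OF that] ann sig pos])
  have "L \<noteq> []"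
    using pos by auto
  then have "\<Omega> \<noteq> {}"
    using sig[of "fst (hd L)" "snd (hd L)"] hd_in_set[of L] by auto
  then have "?N (\<lambda>x. f x - P x) \<le> E"
    unfolding sup_norm_def using le by (intro cSUP_least) auto
  then have eq: "?N (\<lambda>x. f x - P x) = E"
    using lower[OF mem] by simp
  show "best_approximant V f \<Omega> (\<lambda>x. f x - P x)"
    unfolding best_approximant_def eq using mem lower by blast
  have "Inf (?N ` V) \<le> ?N (\<lambda>x. f x - P x)"
    using mem lower by (intro cINF_lower) (auto simp: bdd_below_def)
  moreover have "E \<le> Inf (?N ` V)"
    using mem lower by (intro cINF_greatest) auto
  ultimately show "best_approx_error V f \<Omega> = E"
    unfolding best_approx_error_def using eq by simp
qed

section \<open>The space of polynomials of bounded total degree\<close>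

lemma poly_spaceI:
  assumes "\<And>x. p x = (\<Sum>k | total_degree k \<le> n. a k * monomial_fun k x)"
  shows "p \<in> poly_space n"
  using assms unfolding poly_space_def by auto

lemma poly_space_monomial:
  assumes "total_degree k \<le> n"
  shows "monomial_fun k \<in> poly_space n"
proof -
  have "(\<Sum>j | total_degree j \<le> n. (if j = k then 1 else 0) * monomial_fun j x)
      = (\<Sum>j | total_degree j \<le> n. if j = k then monomial_fun j x else 0)" for x
    by (intro sum.cong) auto
  also have "\<dots> x = monomial_fun k x" for x
    using assms by (simp add: finite_total_degree_le sum.delta)
  finally show ?thesis
    by (intro poly_spaceI[where a = "\<lambda>j. if j = k then 1 else 0"]) simp
qed

lemma poly_space_add:
  assumes "p \<in> poly_space n" "q \<in> poly_space n"
  shows "(\<lambda>x. p x + q x) \<in> poly_space n"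
proof -
  from assms obtain a b where
    "\<forall>x. p x = (\<Sum>k | total_degree k \<le> n. a k * monomial_fun k x)"
    "\<forall>x. q x = (\<Sum>k | total_degree k \<le> n. b k * monomial_fun k x)"
    unfolding poly_space_def by blast
  then have "p x + q x = (\<Sum>k | total_degree k \<le> n. (a k + b k) * monomial_fun k x)" for x
    by (simp add: sum.distrib distrib_right)
  then show ?thesis
    by (rule poly_spaceI[where a = "\<lambda>k. a k + b k"])
qed

lemma poly_space_scale:
  assumes "p \<in> poly_space n"
  shows "(\<lambda>x. r * p x) \<in> poly_space n"
proof -
  from assms obtain a where
    "\<forall>x. p x = (\<Sum>k | total_degree k \<le> n. a k * monomial_fun k x)"
    unfolding poly_space_def by blast
  then have "r * p x = (\<Sum>k | total_degree k \<le> n. (r * a k) * monomial_fun k x)" for x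
    by (simp add: sum_distrib_left mult.assoc)
  then show ?thesis
    by (rule poly_spaceI[where a = "\<lambda>k. r * a k"])
qed

lemma monomial_fun_3:
  fixes x :: "real ^ 3"
  shows "monomial_fun k x = (x $ 1) ^ (k $ 1) * (x $ 2) ^ (k $ 2) * (x $ 3) ^ (k $ 3)"
  unfolding monomial_fun_def UNIV_3 by (simp add: mult.assoc)

lemma total_degree_3:
  fixes k :: "nat ^ 3"
  shows "total_degree k = k $ 1 + k $ 2 + k $ 3"
  by (simp only: total_degree_def sum_3)

lemma poly_space_monomial_3:
  assumes "a + b + d \<le> n"
  shows "(\<lambda>x :: real ^ 3. (x $ 1) ^ a * (x $ 2) ^ b * (x $ 3) ^ d) \<in> poly_space n"
  using poly_space_monomial[of "vector [a, b, d] :: nat ^ 3" n] assms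
  by (simp add: monomial_fun_3[abs_def] total_degree_3)

text \<open>
  Finiteness of the supremum norms of the errors comes from the coordinates being in \<open>[0, 1]\<close>:
  the sum of the absolute coefficients bounds a polynomial on the simplex.
\<close>

lemma abs_monomial_le_1:
  assumes "x \<in> std_simplex3"
  shows "\<bar>monomial_fun k x\<bar> \<le> 1"
proof -
  have "0 \<le> x $ i \<and> x $ i \<le> 1" for i
    using assms unfolding std_simplex3_def by (cases i rule: exhaust_3[THEN disjE]) auto
  then show ?thesis
    unfolding monomial_fun_def abs_prod by (intro prod_le_1) (auto simp: power_le_one)
qed

lemma bdd_above_monomial_minus_poly:
  assumes "q \<in> poly_space n"
  shows "bdd_above ((\<lambda>x. \<bar>monomial_fun k x - q x\<bar>) ` std_simplex3)"
proof -
  obtain a where a: "\<And>x. q x = (\<Sum>j | total_degree j \<le> n. a j * monomial_fun j x)"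
    using assms unfolding poly_space_def by blast
  have "\<bar>monomial_fun k x - q x\<bar> \<le> 1 + (\<Sum>j | total_degree j \<le> n. \<bar>a j\<bar>)"
    if x: "x \<in> std_simplex3" for x
  proof -
    have "\<bar>q x\<bar> \<le> (\<Sum>j | total_degree j \<le> n. \<bar>a j * monomial_fun j x\<bar>)"
      unfolding a by (rule sum_abs)
    also have "\<dots> \<le> (\<Sum>j | total_degree j \<le> n. \<bar>a j\<bar>)"
      using abs_monomial_le_1[OF x]
      by (intro sum_mono) (simp add: abs_mult mult_left_le)
    finally show ?thesis
      using abs_monomial_le_1[OF x, of k] by linarith
  qed
  then show ?thesis
    by (rule bdd_aboveI2)
qed

section \<open>An annihilating functional for cubics\<close>

text \<open>
  With \<open>T = 2 \<tau>\<close> and \<open>Y = 2 y\<^sub>0\<close>, the nodes are points of the face \<open>x\<^sub>1 + x\<^sub>2 + x\<^sub>3 = 1\<close>, symmetric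
  under exchanging \<open>x\<^sub>2\<close> and \<open>x\<^sub>3\<close>. On this face the symmetric cubics are spanned by
  \<open>1, s, s\<^sup>2, s\<^sup>3, p, p s\<close>, with \<open>s = x\<^sub>2 + x\<^sub>3\<close> and \<open>p = x\<^sub>2 x\<^sub>3\<close>. Only the last three nodes have
  \<open>p \<noteq> 0\<close>; the conditions for \<open>p\<close> and \<open>p s\<close> determine their weights up to a common factor. The
  others have \<open>s \<in> {0, 1/4, 3/4, 1}\<close>, the extremal points of \<open>T\<^sub>3 (2 s - 1)\<close>, and Lagrange
  interpolation at these four values gives their weights, halved where a value of \<open>s\<close> is shared
  by two mirror images. All weights are multiplied by
  \<open>3 T\<^sup>2 (1 - T)\<close> to clear denominators.
\<close>

definition simplex_signature :: "real \<Rightarrow> real \<Rightarrow> (real \<times> (real ^ 3)) list" where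
  "simplex_signature T Y =
    (let e = Y * (1 - Y) * (Y - T) * T * (1 - T) in
     [((1 - Y) * (1 - T) * (Y - T) * (16 * Y * T - 3 * (Y + T)), vector [1, 0, 0]),
      (- 12 * e, vector [3/4, 1/4, 0]), (- 12 * e, vector [3/4, 0, 1/4]),
      (4 * e, vector [1/4, 3/4, 0]), (4 * e, vector [1/4, 0, 3/4]),
      (- (3/2) * e, vector [0, 1, 0]), (- (3/2) * e, vector [0, 0, 1]),
      (3 * T\<^sup>2 * Y\<^sup>2 * (Y - T), vector [0, 1/2, 1/2]),
      (3 * Y\<^sup>2 * (1 - Y), vector [1 - T, T/2, T/2]),
      (- 3 * T\<^sup>2 * (1 - T), vector [1 - Y, Y/2, Y/2])])"

text \<open>
  For each of the twenty exponents the claim is a polynomial identity in \<open>T\<close> and \<open>Y\<close>.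
\<close>

lemma simplex_signature_monomial:
  assumes "total_degree k \<le> 3"
  shows "(\<Sum>(w, x)\<leftarrow>simplex_signature T Y. w * monomial_fun k x) = 0"
proof -
  obtain a b d where k: "k $ 1 = a" "k $ 2 = b" "k $ 3 = d"
    by blast
  have "a + b + d \<le> 3"
    using assms k by (simp add: total_degree_3)
  then have "a \<in> {0, 1, 2, 3}" "b \<in> {0, 1, 2, 3}" "d \<in> {0, 1, 2, 3}" "a + b + d \<le> 3"
    by auto
  then show ?thesis
    unfolding simplex_signature_def Let_def monomial_fun_3
    by (simp add: k, elim disjE) (simp_all add: power2_eq_square power3_eq_cube field_simps)
qed

lemma simplex_signature_annihilates:
  assumes "p \<in> poly_space 3"
  shows "(\<Sum>(w, x)\<leftarrow>simplex_signature T Y. w * p x) = 0"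
proof -
  obtain a where a: "\<And>x. p x = (\<Sum>j | total_degree j \<le> 3. a j * monomial_fun j x)"
    using assms unfolding poly_space_def by blast
  have swap: "(\<Sum>(w, x)\<leftarrow>L. w * p x)
      = (\<Sum>j | total_degree j \<le> 3. a j * (\<Sum>(w, x)\<leftarrow>L. w * monomial_fun j x))" for L
    by (induction L) (auto simp: a distrib_left sum.distrib sum_distrib_left mult.left_commute)
  show ?thesis
    unfolding swap by (simp add: simplex_signature_monomial)
qed

section \<open>The equation for the parameter\<close>

text \<open>
  The supremum in the equation for \<open>\<tau>\<close> is that of a continuous function on a compact interval, so
  it is attained; this form is what the rest of the argument works with.
\<close>

lemma tau_solution_iff:
  "tau_solution \<tau> \<longleftrightarrow> \<tau> \<in> {0..1/4} \<and>
     (\<forall>y\<in>{0..1/2}. y * (1 - 2 * y) * (y - \<tau>)\<^sup>2 \<le> \<tau>\<^sup>2 / 18) \<and>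
     (\<exists>y\<in>{0..1/2}. y * (1 - 2 * y) * (y - \<tau>)\<^sup>2 = \<tau>\<^sup>2 / 18)"
proof -
  let ?g = "\<lambda>y. y * (1 - 2 * y) * (y - \<tau>)\<^sup>2"
  have "continuous_on {0..1/2} ?g"
    by (intro continuous_intros)
  then obtain z where z: "z \<in> {0..1/2}" "\<And>y. y \<in> {0..1/2} \<Longrightarrow> ?g y \<le> ?g z"
    using continuous_attains_sup[of "{0..1/2::real}" ?g] by auto
  then have "(SUP y\<in>{0..1/2}. ?g y) = ?g z"
    by (intro cSup_eq_maximum) auto
  then show ?thesis
    unfolding tau_solution_def using z by (metis (no_types, lifting) order.antisym)
qed

text \<open>
  To the left of \<open>\<tau>\<close> there is slack: there \<open>\<tau> - y \<le> \<tau> (1 - 4 y)\<close>, because \<open>\<tau> \<le> 1/4\<close>, and with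
  \<open>u = 1 - 4 y\<close> the remaining factor is \<open>(1 - u\<^sup>2) u\<^sup>2 / 8 \<le> 1/32\<close>. Since \<open>1/32 < 1/18\<close>, the maximum
  in the equation for \<open>\<tau>\<close> is attained to the right of \<open>\<tau>\<close>.
\<close>

lemma quartic_left_of_tau:
  fixes y \<tau> :: real
  assumes "0 \<le> y" "y \<le> \<tau>" "\<tau> \<le> 1/4"
  shows "y * (1 - 2 * y) * (y - \<tau>)\<^sup>2 \<le> \<tau>\<^sup>2 / 32"
proof -
  have "\<tau> - y \<le> \<tau> * (1 - 4 * y)"
    using mult_right_mono[of "4 * \<tau>" 1 y] assms by (simp add: algebra_simps)
  then have "(\<tau> - y)\<^sup>2 \<le> (\<tau> * (1 - 4 * y))\<^sup>2"
    using assms by (intro power_mono) auto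
  then have "y * (1 - 2 * y) * (y - \<tau>)\<^sup>2 \<le> y * (1 - 2 * y) * (\<tau> * (1 - 4 * y))\<^sup>2"
    using assms by (intro mult_left_mono) (auto simp: power2_commute)
  also have "\<dots> = \<tau>\<^sup>2 * (1/32 - (1 - 2 * (1 - 4 * y)\<^sup>2)\<^sup>2 / 32)"
    by algebra
  also have "\<dots> \<le> \<tau>\<^sup>2 * (1/32)"
    by (intro mult_left_mono) auto
  finally show ?thesis
    by simp
qed

lemma tau_solutionE:
  assumes "tau_solution \<tau>"
  obtains y where "0 < \<tau>" "\<tau> < y" "y < 1/2" "y * (1 - 2 * y) * (y - \<tau>)\<^sup>2 = \<tau>\<^sup>2 / 18"
proof -
  have \<tau>: "0 \<le> \<tau>" "\<tau> \<le> 1/4"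
    and le: "\<And>y. y \<in> {0..1/2} \<Longrightarrow> y * (1 - 2 * y) * (y - \<tau>)\<^sup>2 \<le> \<tau>\<^sup>2 / 18"
    using assms unfolding tau_solution_iff by auto
  obtain y where y: "0 \<le> y" "y \<le> 1/2" "y * (1 - 2 * y) * (y - \<tau>)\<^sup>2 = \<tau>\<^sup>2 / 18"
    using assms unfolding tau_solution_iff by auto
  have "\<tau> \<noteq> 0"
    using le[of "1/4"] by (auto simp: power2_eq_square)
  then have "0 < \<tau>\<^sup>2" "0 < \<tau>"
    using \<tau> by auto
  have "\<tau> < y"
    using quartic_left_of_tau[of y \<tau>] y \<tau> \<open>0 < \<tau>\<^sup>2\<close> by (cases "\<tau> < y") auto
  moreover have "1 - 2 * y \<noteq> 0"
  proof
    assume "1 - 2 * y = 0"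
    then show False
      using y(3)[unfolded \<open>1 - 2 * y = 0\<close>] \<open>0 < \<tau>\<close> by simp
  qed
  ultimately show ?thesis
    using that[of y] y \<open>0 < \<tau>\<close> by auto
qed

text \<open>
  For fixed \<open>y\<close>, the quotient \<open>(y - \<tau>) / \<tau>\<close> is strictly decreasing in \<open>\<tau>\<close>. So at the point where the
  larger solution attains its maximum, the smaller one would exceed its bound.
\<close>

lemma tau_solution_not_less:
  assumes "tau_solution \<sigma>" "tau_solution \<tau>"
  shows "\<not> \<sigma> < \<tau>"
proof
  assume less: "\<sigma> < \<tau>"
  obtain y where y: "0 < \<tau>" "\<tau> < y" "y < 1/2" "y * (1 - 2 * y) * (y - \<tau>)\<^sup>2 = \<tau>\<^sup>2 / 18"
    using tau_solutionE[OF assms(2)] .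
  have "0 < \<sigma>"
    using tau_solutionE[OF assms(1)] by blast
  have "y * (1 - 2 * y) * (y - \<sigma>)\<^sup>2 \<le> \<sigma>\<^sup>2 / 18"
    using assms(1) y unfolding tau_solution_iff by auto
  then have "y * (1 - 2 * y) * (\<tau> * (y - \<sigma>))\<^sup>2 \<le> \<tau>\<^sup>2 * \<sigma>\<^sup>2 / 18"
    using mult_left_mono[of _ _ "\<tau>\<^sup>2"] by (fastforce simp: power_mult_distrib mult_ac)
  also have "\<dots> = y * (1 - 2 * y) * (\<sigma> * (y - \<tau>))\<^sup>2"
    using y(4) by algebra
  finally have "(\<tau> * (y - \<sigma>))\<^sup>2 \<le> (\<sigma> * (y - \<tau>))\<^sup>2"
    using y by (simp add: mult_le_cancel_left)
  moreover have "\<sigma> * y < \<tau> * y"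
    using less y by simp
  then have "\<sigma> * (y - \<tau>) < \<tau> * (y - \<sigma>)"
    by (simp add: algebra_simps)
  then have "(\<sigma> * (y - \<tau>))\<^sup>2 < (\<tau> * (y - \<sigma>))\<^sup>2"
    using y \<open>0 < \<sigma>\<close> by (intro power_strict_mono) auto
  ultimately show False
    by simp
qed

text \<open>
  For \<open>y \<ge> \<tau>\<close> a square root turns the inequality \<open>y (1 - 2 y) (y - \<tau>)\<^sup>2 \<le> \<tau>\<^sup>2 / 18\<close> into
  \<open>s y * (y - \<tau>) \<le> r * \<tau>\<close>, which is linear in \<open>\<tau>\<close> and solved by \<open>h y \<le> \<tau>\<close>. The maximum of \<open>h\<close> is
  therefore a solution.
\<close>

lemma ex_tau_solution: "\<exists>\<tau>. tau_solution \<tau>"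
proof -
  define s where "s y = sqrt (y * (1 - 2 * y))" for y :: real
  define r :: real where "r = sqrt (1/18)"
  define h where "h y = y * s y / (r + s y)" for y
  have r: "0 < r" "r\<^sup>2 = 1/18"
    by (auto simp: r_def)
  have s: "0 \<le> s y" "(s y)\<^sup>2 = y * (1 - 2 * y)" if "y \<in> {0..1/2}" for y
    using that by (auto simp: s_def)
  have "continuous_on {0..1/2} s"
    unfolding s_def by (intro continuous_intros)
  moreover have "r + s y \<noteq> 0" if "y \<in> {0..1/2}" for y
    using s(1)[OF that] r(1) by linarith
  ultimately have "continuous_on {0..1/2} h"
    unfolding h_def by (intro continuous_intros) auto
  then obtain z where z: "z \<in> {0..1/2}" "\<And>y. y \<in> {0..1/2} \<Longrightarrow> h y \<le> h z"
    using continuous_attains_sup[of "{0..1/2::real}" h] by auto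
  define \<tau> where "\<tau> = h z"
  have le: "s y * (y - \<tau>) \<le> r * \<tau>" if "y \<in> {0..1/2}" for y
    using z(2)[OF that] s(1)[OF that] r(1) by (simp add: h_def[of y] \<tau>_def divide_le_eq algebra_simps)
  have eq: "s z * (z - \<tau>) = r * \<tau>"
    using s(1)[OF z(1)] r(1) by (simp add: \<tau>_def h_def field_simps)
  have "0 \<le> \<tau>"
    using z(1) s(1)[OF z(1)] r(1) by (simp add: \<tau>_def h_def)
  have "\<tau> \<le> 1/4"
  proof -
    have "(s z * (z - 1/4))\<^sup>2 = z * (1 - 2 * z) * (z - 1/4)\<^sup>2"
      by (simp add: power_mult_distrib s(2)[OF z(1)])
    also have "\<dots> = 1/512 - 2 * ((z - 1/4)\<^sup>2 - 1/32)\<^sup>2"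
      by algebra
    also have "\<dots> \<le> 1/288"
      using zero_le_power2[of "(z - 1/4)\<^sup>2 - 1/32"] by linarith
    also have "\<dots> = (r/4)\<^sup>2"
      by (simp add: power_divide r)
    finally have "s z * (z - 1/4) \<le> r/4"
      using r(1) by (simp add: power2_le_iff_abs_le)
    then have "z * s z \<le> (r + s z) * (1/4)"
      by (simp add: algebra_simps)
    then show ?thesis
      using s(1)[OF z(1)] r(1) by (simp add: \<tau>_def h_def divide_le_eq)
  qed
  have "y * (1 - 2 * y) * (y - \<tau>)\<^sup>2 \<le> \<tau>\<^sup>2 / 18" if y: "y \<in> {0..1/2}" for y
  proof (cases "y \<le> \<tau>")
    case True
    then show ?thesis
      using quartic_left_of_tau[of y \<tau>] y \<open>\<tau> \<le> 1/4\<close> zero_le_power2[of \<tau>]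
      unfolding atLeastAtMost_iff by linarith
  next
    case False
    then have "(s y * (y - \<tau>))\<^sup>2 \<le> (r * \<tau>)\<^sup>2"
      using le[OF y] s(1)[OF y] by (intro power_mono) auto
    then show ?thesis
      by (simp add: power_mult_distrib s(2)[OF y] r)
  qed
  moreover have "z * (1 - 2 * z) * (z - \<tau>)\<^sup>2 = \<tau>\<^sup>2 / 18"
    using arg_cong[OF eq, of "\<lambda>t. t\<^sup>2"] by (simp add: power_mult_distrib s(2)[OF z(1)] r)
  ultimately have "tau_solution \<tau>"
    unfolding tau_solution_iff using \<open>0 \<le> \<tau>\<close> \<open>\<tau> \<le> 1/4\<close> z(1) by auto
  then show ?thesis ..
qed

text \<open>
  In terms of \<open>c = - 3 / \<tau>\<close> the equation for \<open>\<tau>\<close> says that \<open>2 y (1 - 2 y) (3 + c y)\<^sup>2\<close> has maximum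
  \<open>1\<close> on \<open>[0, 1/2]\<close>. Numerically \<open>c\<close> is about \<open>- 13.637\<close>, and the maximum is attained near
  \<open>y = 0.4194\<close>.
\<close>

lemma tau_solution_parameter:
  assumes \<tau>: "tau_solution \<tau>" and c: "c = - 3 / \<tau>"
  shows "\<And>y. y \<in> {0..1/2} \<Longrightarrow> 2 * y * (1 - 2 * y) * (3 + c * y)\<^sup>2 \<le> 1"
    and "- 13.65 \<le> c" and "c \<le> - 13.62"
    and "\<exists>y. \<tau> < y \<and> y < 1/2 \<and> 2 * y * (1 - 2 * y) * (3 + c * y)\<^sup>2 = 1"
proof -
  obtain y where y: "0 < \<tau>" "\<tau> < y" "y < 1/2" "y * (1 - 2 * y) * (y - \<tau>)\<^sup>2 = \<tau>\<^sup>2 / 18"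
    using tau_solutionE[OF \<tau>] .
  have scale: "2 * z * (1 - 2 * z) * (3 + c * z)\<^sup>2 = z * (1 - 2 * z) * (z - \<tau>)\<^sup>2 * (18 / \<tau>\<^sup>2)" for z
    using y(1) by (simp add: c field_simps power2_eq_square)
  show le: "2 * z * (1 - 2 * z) * (3 + c * z)\<^sup>2 \<le> 1" if "z \<in> {0..1/2}" for z
  proof -
    have "z * (1 - 2 * z) * (z - \<tau>)\<^sup>2 \<le> \<tau>\<^sup>2 / 18"
      using \<tau> that unfolding tau_solution_iff by auto
    then show ?thesis
      unfolding scale using y(1) by (simp add: field_simps)
  qed
  have eq: "2 * y * (1 - 2 * y) * (3 + c * y)\<^sup>2 = 1"
    unfolding scale y(4) using y(1) by simp
  then show "\<exists>y. \<tau> < y \<and> y < 1/2 \<and> 2 * y * (1 - 2 * y) * (3 + c * y)\<^sup>2 = 1"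
    using y by blast
  show "- 13.65 \<le> c"
  proof (rule ccontr)
    assume "\<not> ?thesis"
    \<comment> \<open>at \<open>y = 0.42\<close>, close to the maximum point, the bound by \<open>1\<close> would fail\<close>
    then have "2.733 \<le> - (3 + c * 0.42)"
      by simp
    then have "2.733\<^sup>2 \<le> (- (3 + c * 0.42))\<^sup>2"
      by (intro power_mono) auto
    then have "2.733\<^sup>2 \<le> (3 + c * 0.42)\<^sup>2"
      by (simp only: power2_minus)
    then show False
      using le[of "0.42"] by (simp add: power2_eq_square)
  qed
  show "c \<le> - 13.62"
  proof (rule ccontr)
    assume "\<not> ?thesis"
    then have c': "- c < 13.62"
      by linarith
    \<comment> \<open>The arithmetic-geometric mean inequality \<open>2 y (1 - 2 y) \<le> ?M\<^sup>2\<close> for the numbers \<open>2 y k\<close> and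
      \<open>(1 - 2 y) / k\<close> with \<open>k = 7/16\<close> is almost sharp near the maximum point, and reduces the
      claim to a quadratic in \<open>y\<close>.\<close>
    let ?v = "- c * y - 3" and ?M = "(128 - 207 * y) / 112"
    have v: "0 \<le> ?v" "?v \<le> 13.62 * y - 3"
      using y mult_right_mono[of "- c" "13.62" y] c' by (auto simp: c field_simps)
    have "2 * y * (1 - 2 * y) = ?M\<^sup>2 - (y * 7/16 - (1 - 2 * y) * 8/7)\<^sup>2"
      by (simp add: power2_eq_square field_simps)
    then have "2 * y * (1 - 2 * y) * ?v\<^sup>2 \<le> ?M\<^sup>2 * ?v\<^sup>2"
      by (intro mult_right_mono) auto
    moreover have "2 * y * (1 - 2 * y) * ?v\<^sup>2 = 1"
      using eq by (simp add: power2_eq_square algebra_simps)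
    ultimately have "1 \<le> (?M * ?v)\<^sup>2"
      unfolding power_mult_distrib by linarith
    moreover have "?M * ?v \<le> ?M * (13.62 * y - 3)"
      using v y by (intro mult_left_mono) auto
    moreover have "?M * (13.62 * y - 3) < 1"
    proof -
      have "y\<^sup>2 \<ge> 8386/10000 * y - 17581249/100000000"
        using zero_le_power2[of "y - 4193/10000"] by (simp add: power2_eq_square field_simps)
      then have "- (140967/5600) * y\<^sup>2 + 59109/2800 * y - 24/7 < 1"
        using y by linarith
      moreover have "?M * (13.62 * y - 3)
          = - (140967/5600) * y\<^sup>2 + 59109/2800 * y - 24/7"
        by (simp add: power2_eq_square field_simps)
      ultimately show ?thesis
        by (simp only:)
    qed
    moreover have "0 \<le> ?M * ?v"
      using v y by auto
    ultimately have "1 \<le> (?M * ?v)\<^sup>2" "0 \<le> ?M * ?v" "?M * ?v < 1"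
      by linarith+
    then show False
      using power_strict_mono[of "?M * ?v" 1 2] by simp
  qed
qed

section \<open>The bound for the two extreme values of the product of the last two coordinates\<close>

text \<open>
  The values of \<open>Q\<close> for \<open>x\<^sub>2 x\<^sub>3 = 0\<close>. The upper bound is \<open>8 x (s - x) \<le> 8 x (1 - 2 x) \<le> 1\<close>. The lower
  bound is immediate for \<open>x \<le> s\<close>; otherwise the expression decreases in \<open>x\<close>, so the worst case
  is \<open>x = 1 - s\<close>, where \<open>- T\<^sub>3 (2 s - 1) + 1 = 2 (1 - s) (1 - 4 s)\<^sup>2\<close>.
\<close>

lemma cubic_edge_bound:
  fixes x s :: real
  assumes "0 \<le> x" "0 \<le> s" "x + s \<le> 1"
  shows "\<bar>1 - 2 * s + 16 * x * s * (s - x)\<bar> \<le> 1"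
proof -
  have "x * (s - x) \<le> x * (1 - 2 * x)"
    using assms by (intro mult_left_mono) auto
  also have "\<dots> \<le> 1/8"
    using zero_le_power2[of "1 - 4 * x"] by (simp add: power2_eq_square algebra_simps)
  finally have "s * (8 * (x * (s - x))) \<le> s * 1"
    using assms by (intro mult_left_mono) auto
  moreover have "s * (1 - 8 * (x * (s - x))) \<le> 1"
  proof (cases "x \<le> s")
    case True
    then have "s * (1 - 8 * (x * (s - x))) \<le> s * 1"
      using assms by (intro mult_left_mono) auto
    then show ?thesis
      using assms by simp
  next
    case False
    then have "x * (x - s) \<le> (1 - s) * (1 - 2 * s)"
      using assms by (intro mult_mono) auto
    then have "s * (1 - 8 * (x * (s - x))) \<le> s * (1 + 8 * ((1 - s) * (1 - 2 * s)))"
      using assms by (intro mult_left_mono) (auto simp: algebra_simps)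
    also have "\<dots> = 1 - (1 - s) * (1 - 4 * s)\<^sup>2"
      by algebra
    also have "\<dots> \<le> 1"
      using assms by auto
    finally show ?thesis .
  qed
  ultimately show ?thesis
    by (simp add: algebra_simps abs_le_iff)
qed

text \<open>
  The values of \<open>Q\<close> for \<open>x\<^sub>2 = x\<^sub>3 = y\<close>. For fixed \<open>y\<close> this is a quadratic \<open>R\<close> in \<open>x\<close> on \<open>[0, z]\<close>,
  \<open>z = 1 - 2 y\<close>, with \<open>R 0 \<le> 1\<close> and \<open>B \<le> 0\<close> as linear coefficient, and \<open>R z\<close> is controlled by
  the hypothesis \<open>edge\<close>. The upper bound follows from convexity, or from monotonicity when \<open>R\<close> is
  concave. For the lower bound, \<open>R\<close> is decreasing on \<open>[0, z]\<close> unless \<open>0.1 < y < 0.409\<close>; in that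
  range \<open>R\<close> is convex and the discriminant of \<open>R + 1\<close> is nonpositive. The two ranges overlap by
  little (the discriminant changes sign near \<open>y = 0.414\<close> and the slope of \<open>R\<close> at \<open>z\<close> near
  \<open>y = 0.407\<close>), which dictates the accuracy required of \<open>c\<close>.
\<close>

lemma quartic_symmetric_bound:
  fixes x y c :: real
  assumes c: "- 13.65 \<le> c" "c \<le> - 13.62"
    and edge: "2 * y * (1 - 2 * y) * (3 + c * y)\<^sup>2 \<le> 1"
    and xy: "0 \<le> x" "0 \<le> y" "x + 2 * y \<le> 1"
  shows "\<bar>1 - 4 * y * (1 - 2 * y) - 2 * y\<^sup>2 * ((c + 4) * (c + 8)) * x
      + 2 * y * (c\<^sup>2 * y - 16) * x\<^sup>2\<bar> \<le> 1"
proof -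
  define z where "z = 1 - 2 * y"
  define n where "n = (c + 4) * (c + 8)"
  define m where "m = c\<^sup>2"
  define A where "A = 2 * y * (m * y - 16)"
  define B where "B = - 2 * y\<^sup>2 * n"
  define R where "R t = 1 - 4 * y * z + B * t + A * t\<^sup>2" for t
  have z: "x \<le> z" "0 \<le> z"
    using xy by (auto simp: z_def)
  have m: "185.5 \<le> m" "m \<le> 186.33"
  proof -
    have "13.62\<^sup>2 \<le> (- c)\<^sup>2" "(- c)\<^sup>2 \<le> 13.65\<^sup>2"
      using c by (intro power_mono; simp)+
    then show "185.5 \<le> m" "m \<le> 186.33"
      by (auto simp: m_def power2_eq_square)
  qed
  have n: "54.06 \<le> n" "n \<le> 54.523"
  proof -
    have "9.62 * 5.62 \<le> (- c - 4) * (- c - 8)" "(- c - 4) * (- c - 8) \<le> 9.65 * 5.65"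
      using c by (intro mult_mono; simp)+
    then show "54.06 \<le> n" "n \<le> 54.523"
      by (auto simp: n_def algebra_simps)
  qed
  have B: "B \<le> 0"
    using n by (simp add: B_def)
  have Rz: "R z = 1 - 4 * y * z * (3 + c * y)\<^sup>2"
    unfolding R_def A_def B_def n_def m_def z_def by algebra
  have Rz_bounds: "R z \<le> 1" "- 1 \<le> R z"
    using edge z xy unfolding Rz by (auto simp: z_def[symmetric])
  have R0: "1 - 4 * y * z \<le> 1"
    using z xy by simp
  have upper: "R x \<le> 1"
  proof (cases "B + A * z \<le> 0")
    case True
    have "A * x \<le> max 0 (A * z)"
      using z xy by (cases "0 \<le> A") (auto simp: le_max_iff_disj mult_left_mono mult_nonpos_nonneg)
    then have "x * (B + A * x) \<le> 0"
      using True B xy by (intro mult_nonneg_nonpos) auto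
    then show ?thesis
      using R0 by (simp add: R_def power2_eq_square algebra_simps)
  next
    case False
    then have "0 < A * z"
      using B by linarith
    then have "0 \<le> A"
      using z by (auto simp: zero_less_mult_iff)
    have "R x \<le> 1 - 4 * y * z + x * (B + A * z)"
      using mult_left_mono[OF z(1), of "A * x"] \<open>0 \<le> A\<close> xy
      by (simp add: R_def power2_eq_square algebra_simps)
    also have "\<dots> \<le> 1 - 4 * y * z + z * (B + A * z)"
      using False z by (simp add: mult_right_mono)
    also have "\<dots> = R z"
      by (simp add: R_def power2_eq_square algebra_simps)
    finally show ?thesis
      using Rz_bounds by simp
  qed
  have lower: "- 1 \<le> R x"
  proof (cases "y \<le> 0.1 \<or> 0.409 \<le> y")
    case True
    have "2 * z * (186.33 * y - 16) \<le> 54.06 * y"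
    proof -
      have "54.06 * y - 2 * z * (186.33 * y - 16) = 18633/25 * y\<^sup>2 - 1913/5 * y + 32"
        by (simp add: z_def power2_eq_square field_simps)
      moreover have "y\<^sup>2 \<ge> 1/5 * y - 1/100" "y\<^sup>2 \<ge> 409/500 * y - 167281/1000000"
        using zero_le_power2[of "y - 1/10"] zero_le_power2[of "y - 409/1000"]
        by (simp_all add: power2_eq_square field_simps)
      moreover have "y \<le> 1/10 \<or> 409/1000 \<le> y"
        using True by simp
      ultimately show ?thesis
        by linarith
    qed
    moreover have "2 * z * (m * y - 16) \<le> 2 * z * (186.33 * y - 16)"
      using mult_right_mono[OF m(2) xy(2)] z by (intro mult_left_mono) auto
    moreover have "54.06 * y \<le> n * y"
      using n xy by (intro mult_right_mono) auto
    ultimately have "2 * y * (2 * z * (m * y - 16)) \<le> 2 * y * (n * y)"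
      using xy by (intro mult_left_mono) auto
    then have "B + 2 * A * z \<le> 0"
      by (simp add: A_def B_def power2_eq_square algebra_simps)
    moreover have "A * (x + z) \<le> max 0 (A * (2 * z))"
      using z xy by (cases "0 \<le> A") (auto simp: le_max_iff_disj mult_left_mono mult_nonpos_nonneg)
    ultimately have "0 \<le> (x - z) * (B + A * (x + z))"
      using B z by (intro mult_nonpos_nonpos) auto
    also have "\<dots> = R x - R z"
      by (simp add: R_def power2_eq_square algebra_simps)
    finally show ?thesis
      using Rz_bounds by simp
  next
    case False
    have "16 < 185.5 * y"
      using False by simp
    also have "\<dots> \<le> m * y"
      using m xy by (intro mult_right_mono) auto
    finally have A: "0 < A"
      using False by (simp add: A_def)
    have "n\<^sup>2 \<le> 54.523\<^sup>2"
      using n by (intro power_mono) auto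
    then have "n\<^sup>2 * y ^ 3 \<le> 2973 * y ^ 3"
      using xy by (intro mult_right_mono) (auto simp: power2_eq_square)
    also have "2973 * y ^ 3 \<le> 4 * (185.5 * y - 16) * (1 - 2 * y + 4 * y\<^sup>2)"
    proof -
      have "0 \<le> (y - 1/10) * (409/1000 - y)"
        using False by (intro mult_nonneg_nonneg) auto
      then have quad: "y\<^sup>2 \<le> 509/1000 * y - 409/10000"
        by (simp add: power2_eq_square field_simps)
      have "y\<^sup>2 * y \<le> y\<^sup>2 * (409/1000)"
        using False by (intro mult_left_mono) auto
      then have cube: "y ^ 3 \<le> 409/1000 * y\<^sup>2"
        by (simp add: power2_eq_square power3_eq_cube)
      have "y \<le> 409/1000"
        using False by simp
      then have "2973 * y ^ 3 \<le> 2968 * y ^ 3 - 1740 * y\<^sup>2 + 870 * y - 64"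
        using quad cube by linarith
      also have "\<dots> = 4 * (185.5 * y - 16) * (1 - 2 * y + 4 * y\<^sup>2)"
        by (simp add: power2_eq_square power3_eq_cube field_simps)
      finally show ?thesis .
    qed
    also have "\<dots> \<le> 4 * (m * y - 16) * (1 - 2 * y + 4 * y\<^sup>2)"
    proof (intro mult_right_mono)
      show "0 \<le> 1 - 2 * y + 4 * y\<^sup>2"
        using zero_le_power2[of "1 - 4 * y"] by (simp add: power2_eq_square algebra_simps)
    qed (use mult_right_mono[OF m(1) xy(2)] in simp)
    finally have "4 * y * (n\<^sup>2 * y ^ 3) \<le> 4 * y * (4 * (m * y - 16) * (1 - 2 * y + 4 * y\<^sup>2))"
      using xy by (intro mult_left_mono) auto
    then have disc: "B\<^sup>2 \<le> 4 * A * (2 - 4 * y * z)"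
      unfolding A_def B_def z_def
      by (simp add: power2_eq_square power3_eq_cube algebra_simps)
    have "4 * A * (R x + 1) = (2 * A * x + B)\<^sup>2 + (4 * A * (2 - 4 * y * z) - B\<^sup>2)"
      unfolding R_def by algebra
    then have "0 \<le> 4 * A * (R x + 1)"
      using disc zero_le_power2[of "2 * A * x + B"] by linarith
    then show ?thesis
      using A by (simp add: zero_le_mult_iff)
  qed
  show ?thesis
    using upper lower unfolding R_def A_def B_def n_def m_def z_def by (simp add: abs_le_iff)
qed

section \<open>The scaled polynomial on the simplex\<close>

lemma affine_abs_le:
  fixes a b p r :: real
  assumes "\<bar>a\<bar> \<le> e" "\<bar>a + b * r\<bar> \<le> e" "0 \<le> p" "p \<le> r"
  shows "\<bar>a + b * p\<bar> \<le> e"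
proof (cases "0 \<le> b")
  case True
  then have "0 \<le> b * p" "b * p \<le> b * r"
    using assms by (auto intro: mult_left_mono)
  then show ?thesis
    using assms by linarith
next
  case False
  then have "b * p \<le> 0" "b * r \<le> b * p"
    using assms by (auto intro: mult_left_mono_neg mult_nonpos_nonneg)
  then show ?thesis
    using assms by linarith
qed

definition scaled_chebyshev :: "real \<Rightarrow> real \<Rightarrow> real \<Rightarrow> real \<Rightarrow> real" where
  "scaled_chebyshev c x u v = 2 * c\<^sup>2 * (x\<^sup>2 * u * v) +
     (- 16 * x\<^sup>2 * (u + v) + 16 * x * (u + v)\<^sup>2 - 2 * (64 + 12 * c + c\<^sup>2) * x * u * v
      + 8 * u * v - 2 * (u + v) + 1)"

lemma scaled_chebyshev_bound:
  assumes c: "- 13.65 \<le> c" "c \<le> - 13.62"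
    and edge: "\<And>y. y \<in> {0..1/2} \<Longrightarrow> 2 * y * (1 - 2 * y) * (3 + c * y)\<^sup>2 \<le> 1"
    and nonneg: "0 \<le> x" "0 \<le> u" "0 \<le> v" and le: "x + u + v \<le> 1"
  shows "\<bar>scaled_chebyshev c x u v\<bar> \<le> 1"
proof -
  define y where "y = (u + v) / 2"
  have y: "u + v = 2 * y"
    by (simp add: y_def)
  let ?a = "1 - 2 * (2 * y) + 16 * x * (2 * y) * (2 * y - x)"
  let ?b = "8 + 2 * c\<^sup>2 * x\<^sup>2 - 2 * (64 + 12 * c + c\<^sup>2) * x"
  have xy: "0 \<le> y" "x + 2 * y \<le> 1"
    using nonneg le y by auto
  have p0: "\<bar>?a\<bar> \<le> 1"
    using cubic_edge_bound[of x "2 * y"] nonneg xy by simp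
  have "?a + ?b * y\<^sup>2 = 1 - 4 * y * (1 - 2 * y) - 2 * y\<^sup>2 * ((c + 4) * (c + 8)) * x
      + 2 * y * (c\<^sup>2 * y - 16) * x\<^sup>2"
    by algebra
  then have p1: "\<bar>?a + ?b * y\<^sup>2\<bar> \<le> 1"
    using quartic_symmetric_bound[OF c edge, of y x] nonneg xy by simp
  have "u * v \<le> y\<^sup>2"
    using zero_le_power2[of "u - v"] by (simp add: y_def power2_eq_square field_simps)
  then have "\<bar>?a + ?b * (u * v)\<bar> \<le> 1"
    using nonneg by (intro affine_abs_le[OF p0 p1]) (rule mult_nonneg_nonneg)
  also have "?a + ?b * (u * v) = scaled_chebyshev c x u v"
    unfolding scaled_chebyshev_def y by algebra
  finally show ?thesis .
qed

text \<open>
  This factorization links the polynomial to the equation for \<open>\<tau>\<close>.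
\<close>

lemma scaled_chebyshev_diagonal:
  "scaled_chebyshev c (1 - 2 * y) y y = 1 - 4 * y * (1 - 2 * y) * (3 + c * y)\<^sup>2"
  unfolding scaled_chebyshev_def by algebra

section \<open>The best approximation\<close>

text \<open>
  The hypotheses on \<open>T\<close> and \<open>Y\<close> make \<open>Q\<close> equal to \<open>1\<close> and \<open>- 1\<close> at the last two nodes. Of the weights,
  only that of the vertex \<open>(1, 0, 0)\<close> has a sign that does not follow from \<open>0 < T < Y < 1\<close> alone;
  there \<open>3/8 \<le> T\<close> enters.
\<close>

lemma simplex_signature_extremal:
  assumes TY: "3/8 \<le> T" "T < Y" "Y < 1"
    and T: "3 + c * (T / 2) = 0" and Y: "Y * (1 - Y) * (3 + c * (Y / 2))\<^sup>2 = 1"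
    and wx: "(w, x) \<in> set (simplex_signature T Y)"
  shows "x \<in> std_simplex3 \<and> w * scaled_chebyshev c (x $ 1) (x $ 2) (x $ 3) = \<bar>w\<bar>"
proof -
  define e where "e = Y * (1 - Y) * (Y - T) * T * (1 - T)"
  have e: "0 \<le> e"
    unfolding e_def using TY by (intro mult_nonneg_nonneg) auto
  have "0 \<le> Y * (8 * T - 3) + T * (8 * Y - 3)"
    using TY by (intro add_nonneg_nonneg mult_nonneg_nonneg) simp_all
  also have "\<dots> = 16 * Y * T - 3 * (Y + T)"
    by algebra
  finally have "0 \<le> 16 * Y * T - 3 * (Y + T)" .
  then have vertex: "0 \<le> (1 - Y) * (1 - T) * (Y - T) * (16 * Y * T - 3 * (Y + T))"
    using TY by (intro mult_nonneg_nonneg) simp_all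
  have QT: "scaled_chebyshev c (1 - T) (T / 2) (T / 2) = 1"
    using scaled_chebyshev_diagonal[of c "T / 2"] T by simp
  have QY: "scaled_chebyshev c (1 - Y) (Y / 2) (Y / 2) = - 1"
    using scaled_chebyshev_diagonal[of c "Y / 2"] Y by simp
  have edge: "scaled_chebyshev c 1 0 0 = 1"
    "scaled_chebyshev c (3/4) (1/4) 0 = - 1" "scaled_chebyshev c (3/4) 0 (1/4) = - 1"
    "scaled_chebyshev c (1/4) (3/4) 0 = 1" "scaled_chebyshev c (1/4) 0 (3/4) = 1"
    "scaled_chebyshev c 0 1 0 = - 1" "scaled_chebyshev c 0 0 1 = - 1"
    "scaled_chebyshev c 0 (1/2) (1/2) = 1"
    by (simp_all add: scaled_chebyshev_def power2_eq_square)
  have w: "0 \<le> 3 * T\<^sup>2 * Y\<^sup>2 * (Y - T)" "0 \<le> 3 * Y\<^sup>2 * (1 - Y)" "0 \<le> 3 * T\<^sup>2 * (1 - T)"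
    using TY by auto
  have coeff: "\<bar>- 12 * e\<bar> = 12 * e" "\<bar>4 * e\<bar> = 4 * e" "\<bar>- (3/2) * e\<bar> = 3/2 * e"
    "\<bar>- 3 * T\<^sup>2 * (1 - T)\<bar> = 3 * T\<^sup>2 * (1 - T)"
    using e TY by (simp_all add: abs_mult)
  show ?thesis
    using wx unfolding simplex_signature_def Let_def e_def[symmetric] list.set insert_iff
      empty_iff prod.inject simp_thms
    by (elim disjE conjE; hypsubst; intro conjI)
       (use TY in \<open>simp_all only: coeff abs_of_nonneg[OF vertex] abs_of_nonneg[OF w(1)]
          abs_of_nonneg[OF w(2)] vector_3 edge QT QY std_simplex3_def mem_Collect_eq,
        simp_all\<close>)
qed

lemma simplex_signature_nontrivial:
  assumes "0 < T" "T < 1"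
  shows "(\<Sum>(w, x)\<leftarrow>simplex_signature T Y. \<bar>w\<bar>) > 0"
proof -
  have "0 < 3 * T\<^sup>2 * (1 - T)"
    using assms by simp
  then have "0 < \<bar>- 3 * T\<^sup>2 * (1 - T)\<bar>"
    by simp
  then show ?thesis
    unfolding simplex_signature_def Let_def list.map sum_list.Cons sum_list.Nil prod.case add_0_right
    by (intro add_nonneg_pos abs_ge_zero)
qed

lemma monomial_fun_211:
  "monomial_fun (vector [2, 1, 1] :: nat ^ 3) x = (x $ 1)\<^sup>2 * x $ 2 * x $ 3"
  by (simp add: monomial_fun_3)

text \<open>
  Only the monomial itself has degree \<open>4\<close>, so the correction terms lie in the cubics.
\<close>

lemma scaled_chebyshev_remainder_in_poly_space:
  "(\<lambda>x. monomial_fun (vector [2, 1, 1] :: nat ^ 3) x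
      - ((x $ 1)\<^sup>2 * x $ 2 * x $ 3 + e * (- 16 * (x $ 1)\<^sup>2 * (x $ 2 + x $ 3)
             + 16 * x $ 1 * (x $ 2 + x $ 3)\<^sup>2 - 2 * g * x $ 1 * x $ 2 * x $ 3
             + 8 * x $ 2 * x $ 3 - 2 * (x $ 2 + x $ 3) + 1)))
    \<in> poly_space 3"
proof -
  let ?m = "\<lambda>a b d (x :: real ^ 3). (x $ 1) ^ a * (x $ 2) ^ b * (x $ 3) ^ d"
  have "(\<lambda>x. (16 * e) * ?m 2 1 0 x + ((16 * e) * ?m 2 0 1 x + ((- 16 * e) * ?m 1 2 0 x
        + ((- 32 * e) * ?m 1 1 1 x + ((- 16 * e) * ?m 1 0 2 x + ((2 * e * g) * ?m 1 1 1 x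
        + ((- 8 * e) * ?m 0 1 1 x + ((2 * e) * ?m 0 1 0 x + ((2 * e) * ?m 0 0 1 x
        + (- e) * ?m 0 0 0 x))))))))) \<in> poly_space 3"
    by (intro poly_space_add poly_space_scale poly_space_monomial_3) simp_all
  then show ?thesis
    unfolding monomial_fun_211
    by (rule back_subst[of "\<lambda>p. p \<in> poly_space 3"])
       (simp add: fun_eq_iff power2_eq_square algebra_simps)
qed

theorem theorem11:
  shows "(\<exists>!\<tau>. tau_solution \<tau>) \<and>
    (\<forall>\<tau> c. tau_solution \<tau> \<longrightarrow> c = - 3 / \<tau> \<longrightarrow>
       best_approx_error (poly_space 3) (monomial_fun (vector [2, 1, 1] :: nat ^ 3)) std_simplex3
         = 1 / (2 * c\<^sup>2) \<and>
       chebyshev_polynomial (vector [2, 1, 1] :: nat ^ 3) std_simplex3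
         (\<lambda>x. (x $ 1)\<^sup>2 * x $ 2 * x $ 3 + 1 / (2 * c\<^sup>2) *
            (- 16 * (x $ 1)\<^sup>2 * (x $ 2 + x $ 3)
             + 16 * x $ 1 * (x $ 2 + x $ 3)\<^sup>2
             - 2 * (64 + 12 * c + c\<^sup>2) * x $ 1 * x $ 2 * x $ 3
             + 8 * x $ 2 * x $ 3
             - 2 * (x $ 2 + x $ 3)
             + 1)))"
proof (intro conjI allI impI)
  show "\<exists>!\<tau>. tau_solution \<tau>"
    using ex_tau_solution tau_solution_not_less by (metis linorder_neqE)
next
  fix \<tau> c :: real
  assume \<tau>: "tau_solution \<tau>" and c: "c = - 3 / \<tau>"
  let ?f = "monomial_fun (vector [2, 1, 1] :: nat ^ 3)"
  define E where "E = 1 / (2 * c\<^sup>2)"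
  define P where "P = (\<lambda>x :: real ^ 3. (x $ 1)\<^sup>2 * x $ 2 * x $ 3 + E *
            (- 16 * (x $ 1)\<^sup>2 * (x $ 2 + x $ 3)
             + 16 * x $ 1 * (x $ 2 + x $ 3)\<^sup>2
             - 2 * (64 + 12 * c + c\<^sup>2) * x $ 1 * x $ 2 * x $ 3
             + 8 * x $ 2 * x $ 3
             - 2 * (x $ 2 + x $ 3)
             + 1))"
  note bounds = tau_solution_parameter[OF \<tau> c]
  obtain y where y: "\<tau> < y" "y < 1/2" "2 * y * (1 - 2 * y) * (3 + c * y)\<^sup>2 = 1"
    using bounds(4) by blast
  have "0 < \<tau>"
    using tau_solutionE[OF \<tau>] by blast
  then have c\<tau>: "3 + c * \<tau> = 0"
    by (simp add: c)
  \<comment> \<open>\<open>3 = - c \<tau> \<le> 13.65 \<tau>\<close>, so \<open>2 \<tau>\<close> is about \<open>0.44\<close>, well above \<open>3/8\<close>\<close>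
  have "- (13.65) * \<tau> \<le> c * \<tau>"
    using bounds(2) \<open>0 < \<tau>\<close> by (intro mult_right_mono) auto
  then have T: "3/8 \<le> 2 * \<tau>"
    using c\<tau> by simp
  have E: "0 < E" "E * (2 * c\<^sup>2) = 1"
    using bounds(3) by (auto simp: E_def)
  have P: "P x = E * scaled_chebyshev c (x $ 1) (x $ 2) (x $ 3)" for x
    unfolding P_def scaled_chebyshev_def using E(2) by algebra
  have mem: "(\<lambda>x. ?f x - P x) \<in> poly_space 3"
    unfolding P_def by (rule scaled_chebyshev_remainder_in_poly_space)
  have sig: "x \<in> std_simplex3 \<and> w * P x = \<bar>w\<bar> * E"
    if "(w, x) \<in> set (simplex_signature (2 * \<tau>) (2 * y))" for w x
    using simplex_signature_extremal[OF T _ _ _ _ that, of c] y c\<tau> by (simp add: P mult.left_commute)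
  have le: "\<bar>P x\<bar> \<le> E" if "x \<in> std_simplex3" for x
    using scaled_chebyshev_bound[OF bounds(2,3,1), of "x $ 1" "x $ 2" "x $ 3"] that E(1)
    by (simp add: P abs_mult std_simplex3_def mult_left_le)
  have pos: "(\<Sum>(w, x)\<leftarrow>simplex_signature (2 * \<tau>) (2 * y). \<bar>w\<bar>) > 0"
    using \<open>0 < \<tau>\<close> y by (intro simplex_signature_nontrivial) auto
  note * = best_approximant_of_signature[OF mem bdd_above_monomial_minus_poly
      simplex_signature_annihilates sig pos le]
  show "best_approx_error (poly_space 3) ?f std_simplex3 = 1 / (2 * c\<^sup>2)"
    using *(2) by (simp add: E_def)
  have "chebyshev_polynomial (vector [2, 1, 1] :: nat ^ 3) std_simplex3 P"
    unfolding chebyshev_polynomial_def using *(1)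
    by (auto simp: total_degree_3 intro!: exI[of _ "\<lambda>x. ?f x - P x"])
  then show "chebyshev_polynomial (vector [2, 1, 1] :: nat ^ 3) std_simplex3
         (\<lambda>x. (x $ 1)\<^sup>2 * x $ 2 * x $ 3 + 1 / (2 * c\<^sup>2) *
            (- 16 * (x $ 1)\<^sup>2 * (x $ 2 + x $ 3)
             + 16 * x $ 1 * (x $ 2 + x $ 3)\<^sup>2
             - 2 * (64 + 12 * c + c\<^sup>2) * x $ 1 * x $ 2 * x $ 3
             + 8 * x $ 2 * x $ 3
             - 2 * (x $ 2 + x $ 3)
             + 1))"
    unfolding P_def E_def .
qed

end
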